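(* Let $0\le c_1<c_2$ be such that $c\mapsto PPTP(N,c)$ is linear on the interval $(c_1,c_2)$ (there are no corner points in the interval). Then there is only one optimal set for all $c\in(c_1,c_2)$; that is, there is a set $S\subseteq N$ which, for every $c\in(c_1,c_2)$, is the unique optimal set for $c$.
   Context: Setting (PPTP on a line). The depot is at the origin of the half-line $[0,\infty)$. $N=\{v_1,\dots,v_n\}$ ($n\ge 1$) is the set of potential customers; customer $v_i$ has position $x_i>0$, prize $p_i>0$ and probability $\pi_i\in(0,1]$. Customers are indexed so that $x_i\le x_{i+1}$, and $x_i=x_{i+1}$ implies $\pi_i\le\pi_{i+1}$. Put $l_i=2x_i$. For $S\subseteq N$ define the expected revenue $R(S)=\sum_{v_i\in S}\pi_ip_i$, the expected distance $L(S)=\sum_{v_i\in S} l_i\pi_i\prod_{v_j\in S,\,j>i}(1-\pi_j)$ and, for a unit cost $c\ge 0$, the expected profit $G(S,c)=R(S)-cL(S)$. Empty sums are $0$, empty products are $1$. $PPTP(N,c)=\max_{S\subseteq N}G(S,c)$ for $c\ge0$; a set $S\subseteq N$ attaining the maximum is called an optimal set for $c$. The function $c\mapsto PPTP(N,c)$ on $[0,\infty)$ is piecewise linear, and a corner point is a point $c>0$ at which its slope changes (the left and right slopes differ). Here "linear" means affine in $c$. *)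

theory Defs
  imports Complex_Main
begin

text \<open>
  Customers are represented by their indices. The data of an instance are the functions
  \<open>x\<close> (positions), \<open>p\<close> (prizes) and \<open>\<pi>\<close> (probabilities) on indices.
\<close>

definition revenue :: "(nat \<Rightarrow> real) \<Rightarrow> (nat \<Rightarrow> real) \<Rightarrow> nat set \<Rightarrow> real" where
  "revenue p \<pi> S = (\<Sum>i\<in>S. \<pi> i * p i)"

text \<open>
  With probability \<open>\<pi> i * (\<Prod>j\<in>{j\<in>S. j > i}. 1 - \<pi> j)\<close>, customer \<open>i\<close> is the last one of \<open>S\<close>
  (in the order of the indices) that is present, and the round trip then has length \<open>2 * x i\<close>.
\<close>

definition distance :: "(nat \<Rightarrow> real) \<Rightarrow> (nat \<Rightarrow> real) \<Rightarrow> nat set \<Rightarrow> real" where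
  "distance x \<pi> S = (\<Sum>i\<in>S. (2 * x i) * \<pi> i * (\<Prod>j\<in>{j\<in>S. j > i}. 1 - \<pi> j))"

definition profit ::
  "(nat \<Rightarrow> real) \<Rightarrow> (nat \<Rightarrow> real) \<Rightarrow> (nat \<Rightarrow> real) \<Rightarrow> nat set \<Rightarrow> real \<Rightarrow> real" where
  "profit x p \<pi> S c = revenue p \<pi> S - c * distance x \<pi> S"

definition PPTP ::
  "(nat \<Rightarrow> real) \<Rightarrow> (nat \<Rightarrow> real) \<Rightarrow> (nat \<Rightarrow> real) \<Rightarrow> nat set \<Rightarrow> real \<Rightarrow> real" where
  "PPTP x p \<pi> N c = Max ((\<lambda>S. profit x p \<pi> S c) ` Pow N)"

definition optimal_set ::
  "(nat \<Rightarrow> real) \<Rightarrow> (nat \<Rightarrow> real) \<Rightarrow> (nat \<Rightarrow> real) \<Rightarrow> nat set \<Rightarrow> real \<Rightarrow> nat set \<Rightarrow> bool" where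
  "optimal_set x p \<pi> N c S \<longleftrightarrow> S \<subseteq> N \<and> profit x p \<pi> S c = PPTP x p \<pi> N c"

end

theory Submission
  imports Defs
begin

text \<open>
  The expected distance of \<open>S\<close> is the expected maximum of \<open>2 * x i\<close> over a random subset of \<open>S\<close>,
  and an expected maximum is a submodular set function. The revenue is additive, so for
  \<open>c \<ge> 0\<close> the profit is supermodular and the union of two optimal sets is optimal again.

  Where the optimal value is affine in \<open>c\<close>, a set that is optimal at one interior point has the
  graph of its profit below an affine function and touching it there; both are affine, so they
  coincide. Hence the set is optimal on the whole interval and its revenue is the constant
  coefficient of the optimal value. If \<open>S\<close> and \<open>T\<close> are optimal, then \<open>S\<close>, \<open>T\<close> and
  \<open>S \<union> T\<close> therefore have the same revenue. As every customer contributes a positive amount to the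
  revenue, \<open>S = S \<union> T = T\<close>.
\<close>

section \<open>Submodularity of the expected distance\<close>

text \<open>
  Conditioning on whether the last customer is present: if so, its position alone determines the
  length of the tour. This recursion drives the inductions below.
\<close>

lemma distance_insert_last:
  assumes "finite S" and last: "\<And>j. j \<in> S \<Longrightarrow> j < b"
  shows "distance x \<pi> (insert b S) = 2 * x b * \<pi> b + (1 - \<pi> b) * distance x \<pi> S"
proof -
  have b: "b \<notin> S" using last by blast
  have none: "{j \<in> insert b S. j > b} = {}" using last by force
  have later: "(\<Prod>j\<in>{j \<in> insert b S. j > i}. 1 - \<pi> j)
      = (1 - \<pi> b) * (\<Prod>j\<in>{j \<in> S. j > i}. 1 - \<pi> j)" if "i \<in> S" for i
  proof -
    have "{j \<in> insert b S. j > i} = insert b {j \<in> S. j > i}"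
      using last[OF that] by auto
    then show ?thesis using assms(1) b by simp
  qed
  have "distance x \<pi> (insert b S)
      = 2 * x b * \<pi> b + (\<Sum>i\<in>S. 2 * x i * \<pi> i * (\<Prod>j\<in>{j \<in> insert b S. j > i}. 1 - \<pi> j))"
    unfolding distance_def sum.insert[OF assms(1) b] none by simp
  also have "(\<Sum>i\<in>S. 2 * x i * \<pi> i * (\<Prod>j\<in>{j \<in> insert b S. j > i}. 1 - \<pi> j))
      = (1 - \<pi> b) * distance x \<pi> S"
    unfolding distance_def sum_distrib_left
    by (rule sum.cong) (simp_all only: later mult.left_commute mult.assoc)
  finally show ?thesis .
qed

lemma distance_le_farthest:
  assumes "finite S" and "m \<ge> 0"
    and "\<And>i. i \<in> S \<Longrightarrow> x i \<le> m" and "\<And>i. i \<in> S \<Longrightarrow> 0 \<le> \<pi> i \<and> \<pi> i \<le> 1"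
  shows "distance x \<pi> S \<le> 2 * m"
  using assms(1,3,4)
proof (induction S rule: finite_linorder_max_induct)
  case empty
  then show ?case using assms(2) by (simp add: distance_def)
next
  case (insert b A)
  have "distance x \<pi> A \<le> 2 * m" using insert by auto
  moreover have "2 * x b \<le> 2 * m" "0 \<le> \<pi> b" "0 \<le> 1 - \<pi> b" using insert by auto
  ultimately have "\<pi> b * (2 * x b) + (1 - \<pi> b) * distance x \<pi> A \<le> \<pi> b * (2 * m) + (1 - \<pi> b) * (2 * m)"
    by (intro add_mono) (simp_all only: mult_left_mono)
  also have "\<dots> = 2 * m" by (simp add: algebra_simps)
  finally show ?case using distance_insert_last insert.hyps by (simp add: mult_ac)
qed

text \<open>
  Adding a last customer replaces the old tour, with some probability, by one that is at least as
  long. This uses that positions increase with the index.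
\<close>

lemma distance_mono:
  assumes "finite B" and "A \<subseteq> B" and "mono_on B x"
    and "\<And>i. i \<in> B \<Longrightarrow> 0 \<le> x i" and "\<And>i. i \<in> B \<Longrightarrow> 0 \<le> \<pi> i \<and> \<pi> i \<le> 1"
  shows "distance x \<pi> A \<le> distance x \<pi> B"
  using assms
proof (induction B arbitrary: A rule: finite_linorder_max_induct)
  case empty
  then show ?case by simp
next
  case (insert b B)
  have B: "distance x \<pi> (insert b B) = 2 * x b * \<pi> b + (1 - \<pi> b) * distance x \<pi> B"
    using distance_insert_last insert.hyps by simp
  have "mono_on B x" using insert.prems(2) by (rule mono_on_subset) auto
  then have IH: "distance x \<pi> A' \<le> distance x \<pi> B" if "A' \<subseteq> B" for A'
    using insert that by auto
  have p: "0 \<le> \<pi> b" "0 \<le> 1 - \<pi> b" using insert.prems by auto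
  show ?case
  proof (cases "b \<in> A")
    case True
    define A' where "A' = A - {b}"
    have A': "A' \<subseteq> B" "A = insert b A'" using True insert.prems(1) by (auto simp: A'_def)
    have "distance x \<pi> A = 2 * x b * \<pi> b + (1 - \<pi> b) * distance x \<pi> A'"
      unfolding A'(2) using A'(1) insert.hyps by (intro distance_insert_last) (auto intro: finite_subset)
    then show ?thesis using B mult_left_mono[OF IH[OF A'(1)] p(2)] by simp
  next
    case False
    then have "A \<subseteq> B" using insert.prems(1) by auto
    note IH[OF this]
    have "distance x \<pi> B \<le> 2 * x b"
      using insert.hyps insert.prems by (intro distance_le_farthest) (auto intro: mono_onD less_imp_le)
    then have "\<pi> b * distance x \<pi> B \<le> \<pi> b * (2 * x b)" using p(1) by (rule mult_left_mono)
    then show ?thesis using \<open>distance x \<pi> A \<le> distance x \<pi> B\<close> B by (simp add: algebra_simps)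
  qed
qed

text \<open>
  Submodularity, by peeling off the last customer. If the last customer lies in only one of the two
  sets, say in \<open>S\<close>, the defect of the inequality is \<open>1 - \<pi> b\<close> times the old one plus \<open>\<pi> b\<close>
  times the excess of the distance of \<open>T\<close> over that of \<open>S \<inter> T\<close>, which is why monotonicity
  is needed.
\<close>

lemma distance_submodular:
  assumes "finite N" and "S \<subseteq> N" and "T \<subseteq> N" and "mono_on N x"
    and "\<And>i. i \<in> N \<Longrightarrow> 0 \<le> x i" and "\<And>i. i \<in> N \<Longrightarrow> 0 \<le> \<pi> i \<and> \<pi> i \<le> 1"
  shows "distance x \<pi> (S \<union> T) + distance x \<pi> (S \<inter> T) \<le> distance x \<pi> S + distance x \<pi> T"
  using assms
proof (induction N arbitrary: S T rule: finite_linorder_max_induct)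
  case empty
  then show ?case by simp
next
  case (insert b N)
  let ?d = "distance x \<pi>"
  have mono: "mono_on N x" using insert.prems(3) by (rule mono_on_subset) auto
  have IH: "?d (A \<union> B) + ?d (A \<inter> B) \<le> ?d A + ?d B" if "A \<subseteq> N" "B \<subseteq> N" for A B
    using insert that mono by auto
  have p: "0 \<le> \<pi> b" "0 \<le> 1 - \<pi> b" using insert.prems by auto
  have last: "?d (insert b A) = 2 * x b * \<pi> b + (1 - \<pi> b) * ?d A" if "A \<subseteq> N" for A
    using that insert.hyps by (intro distance_insert_last) (auto intro: finite_subset)
  have one_sided: "?d (insert b A \<union> B) + ?d (insert b A \<inter> B) \<le> ?d (insert b A) + ?d B"
    if AB: "A \<subseteq> N" "B \<subseteq> N" for A B
  proof -
    have "insert b A \<inter> B = A \<inter> B" using AB insert.hyps by auto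
    moreover have "?d (insert b A \<union> B) = 2 * x b * \<pi> b + (1 - \<pi> b) * ?d (A \<union> B)"
      using last[of "A \<union> B"] AB by simp
    moreover have "?d (A \<inter> B) \<le> ?d B"
      using AB insert.hyps insert.prems mono
      by (intro distance_mono mono_on_subset[OF mono]) (auto intro: finite_subset)
    then have "\<pi> b * ?d (A \<inter> B) \<le> \<pi> b * ?d B" using p(1) by (rule mult_left_mono)
    moreover have "(1 - \<pi> b) * (?d (A \<union> B) + ?d (A \<inter> B)) \<le> (1 - \<pi> b) * (?d A + ?d B)"
      using IH[OF AB] p(2) by (rule mult_left_mono)
    ultimately show ?thesis using last[OF AB(1)] by (simp add: algebra_simps)
  qed
  define S' T' where "S' = S - {b}" and "T' = T - {b}"
  have sub: "S' \<subseteq> N" "T' \<subseteq> N" using insert.prems by (auto simp: S'_def T'_def)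
  consider (both) "S = insert b S'" "T = insert b T'" | (left) "S = insert b S'" "T = T'"
    | (right) "S = S'" "T = insert b T'" | (neither) "S = S'" "T = T'"
    unfolding S'_def T'_def by blast
  then show ?case
  proof cases
    case both
    have "S \<union> T = insert b (S' \<union> T')" "S \<inter> T = insert b (S' \<inter> T')" using both by auto
    moreover have "(1 - \<pi> b) * (?d (S' \<union> T') + ?d (S' \<inter> T')) \<le> (1 - \<pi> b) * (?d S' + ?d T')"
      using IH[OF sub] p(2) by (rule mult_left_mono)
    moreover have "S' \<union> T' \<subseteq> N" "S' \<inter> T' \<subseteq> N" using sub by auto
    ultimately show ?thesis
      using last[of S'] last[of T'] last[of "S' \<union> T'"] last[of "S' \<inter> T'"] sub both
      by (simp add: algebra_simps)
  next
    case left
    then show ?thesis using one_sided sub by simp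
  next
    case right
    then show ?thesis using one_sided[OF sub(2,1)] by (simp add: Un_commute Int_commute add.commute)
  next
    case neither
    then show ?thesis using IH sub by simp
  qed
qed

section \<open>Unions of optimal sets\<close>

lemma profit_le_PPTP:
  assumes "finite N" and "S \<subseteq> N"
  shows "profit x p \<pi> S c \<le> PPTP x p \<pi> N c"
  unfolding PPTP_def using assms by (intro Max_ge) auto

lemma optimal_set_exists:
  assumes "finite N"
  shows "\<exists>S. optimal_set x p \<pi> N c S"
proof -
  have "PPTP x p \<pi> N c \<in> (\<lambda>S. profit x p \<pi> S c) ` Pow N"
    unfolding PPTP_def using assms by (intro Max_in) auto
  then show ?thesis unfolding optimal_set_def by auto
qed

text \<open>
  By supermodularity, \<open>S \<union> T\<close> and \<open>S \<inter> T\<close> together earn at least twice the maximum, while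
  neither of them exceeds it; so both attain it.
\<close>

lemma optimal_set_Un:
  assumes "finite N" and "mono_on N x"
    and "\<And>i. i \<in> N \<Longrightarrow> 0 \<le> x i" and "\<And>i. i \<in> N \<Longrightarrow> 0 \<le> \<pi> i \<and> \<pi> i \<le> 1" and "0 \<le> c"
    and S: "optimal_set x p \<pi> N c S" and T: "optimal_set x p \<pi> N c T"
  shows "optimal_set x p \<pi> N c (S \<union> T)"
proof -
  have sub: "S \<subseteq> N" "T \<subseteq> N" using S T by (auto simp: optimal_set_def)
  have fin: "finite S" "finite T" using sub assms(1) finite_subset by auto
  have "distance x \<pi> (S \<union> T) + distance x \<pi> (S \<inter> T) \<le> distance x \<pi> S + distance x \<pi> T"
    using assms(1) sub assms(2-4) by (rule distance_submodular)
  then have "c * (distance x \<pi> (S \<union> T) + distance x \<pi> (S \<inter> T))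
      \<le> c * (distance x \<pi> S + distance x \<pi> T)"
    using assms(5) by (rule mult_left_mono)
  moreover have "revenue p \<pi> (S \<union> T) + revenue p \<pi> (S \<inter> T) = revenue p \<pi> S + revenue p \<pi> T"
    unfolding revenue_def using fin by (rule sum.union_inter)
  ultimately have "profit x p \<pi> S c + profit x p \<pi> T c
      \<le> profit x p \<pi> (S \<union> T) c + profit x p \<pi> (S \<inter> T) c"
    unfolding profit_def by (simp add: algebra_simps)
  moreover have "profit x p \<pi> (S \<union> T) c \<le> PPTP x p \<pi> N c" "profit x p \<pi> (S \<inter> T) c \<le> PPTP x p \<pi> N c"
    using sub assms(1) by (auto intro!: profit_le_PPTP)
  ultimately show ?thesis using S T by (auto simp: optimal_set_def)
qed

section \<open>Intervals on which the optimal value is affine\<close>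

lemma revenue_eq_imp_subset_eq:
  assumes "finite T" and "S \<subseteq> T" and "\<And>i. i \<in> T \<Longrightarrow> 0 < \<pi> i * p i"
    and "revenue p \<pi> S = revenue p \<pi> T"
  shows "S = T"
proof (rule ccontr)
  assume "S \<noteq> T"
  then obtain b where b: "b \<in> T - S" using assms(2) by auto
  have "revenue p \<pi> S < revenue p \<pi> T"
    unfolding revenue_def using assms(1-3) b by (intro sum_strict_mono2[where b = b]) (auto intro: less_imp_le)
  then show False using assms(4) by simp
qed

lemma affine_touching_interior_eq:
  fixes a b r d c0 c1 c2 :: real
  assumes le: "\<And>c. c \<in> {c1<..<c2} \<Longrightarrow> r - c * d \<le> a + b * c"
    and c0: "c0 \<in> {c1<..<c2}" and eq: "r - c0 * d = a + b * c0"
  shows "r = a \<and> d = - b"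
proof -
  have c: "(c - c0) * (b + d) \<ge> 0" if "c \<in> {c1<..<c2}" for c
    using le[OF that] eq by (simp add: algebra_simps)
  \<comment> \<open>Comparing on both sides of the contact point forces equal slopes.\<close>
  have "((c1 + c0) / 2 - c0) * (b + d) \<ge> 0" "((c0 + c2) / 2 - c0) * (b + d) \<ge> 0"
    using c0 c[of "(c1 + c0) / 2"] c[of "(c0 + c2) / 2"] by auto
  moreover have "(c1 + c0) / 2 - c0 < 0" "(c0 + c2) / 2 - c0 > 0" using c0 by auto
  ultimately have "b + d = 0" by (auto simp: zero_le_mult_iff)
  then have d: "d = - b" by simp
  then show ?thesis using eq by (simp add: algebra_simps)
qed

lemma optimal_set_on_affine_interval:
  assumes "finite N" and aff: "\<And>c. c \<in> {c1<..<c2} \<Longrightarrow> PPTP x p \<pi> N c = a + b * c"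
    and c0: "c0 \<in> {c1<..<c2}" and S: "optimal_set x p \<pi> N c0 S"
  shows "revenue p \<pi> S = a \<and> distance x \<pi> S = - b"
proof (rule affine_touching_interior_eq[OF _ c0])
  show "revenue p \<pi> S - c * distance x \<pi> S \<le> a + b * c" if "c \<in> {c1<..<c2}" for c
    using profit_le_PPTP[OF assms(1), of S x p \<pi> c] S aff[OF that]
    by (simp add: optimal_set_def profit_def)
  show "revenue p \<pi> S - c0 * distance x \<pi> S = a + b * c0"
    using S aff[OF c0] by (simp add: optimal_set_def profit_def)
qed

theorem proposition10:
  fixes n :: nat and x p \<pi> :: "nat \<Rightarrow> real" and c1 c2 :: real
  assumes "n \<ge> 1"
    and "\<And>i. i \<in> {1..n} \<Longrightarrow> x i > 0"
    and "\<And>i. i \<in> {1..n} \<Longrightarrow> p i > 0"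
    and "\<And>i. i \<in> {1..n} \<Longrightarrow> 0 < \<pi> i \<and> \<pi> i \<le> 1"
    and "\<And>i. i \<in> {1..<n} \<Longrightarrow> x i \<le> x (i + 1)"
    and "\<And>i. i \<in> {1..<n} \<Longrightarrow> x i = x (i + 1) \<Longrightarrow> \<pi> i \<le> \<pi> (i + 1)"
    and "0 \<le> c1" and "c1 < c2"
    and "\<exists>a b. \<forall>c\<in>{c1<..<c2}. PPTP x p \<pi> {1..n} c = a + b * c"
  shows "\<exists>S\<subseteq>{1..n}. \<forall>c\<in>{c1<..<c2}.
           optimal_set x p \<pi> {1..n} c S \<and> (\<forall>T. optimal_set x p \<pi> {1..n} c T \<longrightarrow> T = S)"
proof -
  let ?N = "{1..n}" and ?I = "{c1<..<c2}"
  let ?opt = "optimal_set x p \<pi> ?N"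
  obtain a b where aff: "\<And>c. c \<in> ?I \<Longrightarrow> PPTP x p \<pi> ?N c = a + b * c"
    using assms(9) by blast
  have mono: "mono_on ?N x"
  proof (rule mono_onI)
    fix i j assume "i \<in> ?N" "j \<in> ?N" "i \<le> j"
    from this(3,1,2) show "x i \<le> x j"
    proof (induction rule: dec_induct)
      case (step k)
      then show ?case using assms(5)[of k] by simp
    qed simp
  qed
  have coeffs: "revenue p \<pi> T = a \<and> distance x \<pi> T = - b" if "c \<in> ?I" "?opt c T" for c T
    using optimal_set_on_affine_interval[of ?N c1 c2 x p \<pi> a b c T] aff that by simp
  obtain S where S: "?opt ((c1 + c2) / 2) S"
    using optimal_set_exists[of ?N] by blast
  then have sub: "S \<subseteq> ?N" by (simp add: optimal_set_def)
  have S_opt: "?opt c S" if "c \<in> ?I" for c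
  proof -
    have "revenue p \<pi> S = a \<and> distance x \<pi> S = - b"
      using coeffs[OF _ S] assms(8) by simp
    then show ?thesis using sub aff[OF that] by (simp add: optimal_set_def profit_def)
  qed
  have unique: "T = S" if c: "c \<in> ?I" and T: "?opt c T" for c T
  proof -
    have U: "?opt c (S \<union> T)"
      using S_opt[OF c] T mono assms(2,4,7) c
      by (intro optimal_set_Un) (auto intro: less_imp_le)
    have pos: "0 < \<pi> i * p i" if "i \<in> S \<union> T" for i
      using that U assms(3,4) by (auto simp: optimal_set_def)
    have fin: "finite (S \<union> T)" using U finite_subset by (auto simp: optimal_set_def)
    have rev: "revenue p \<pi> S = a" "revenue p \<pi> T = a" "revenue p \<pi> (S \<union> T) = a"
      using coeffs[OF c] S_opt[OF c] T U by auto
    have "S = S \<union> T" using fin pos rev by (intro revenue_eq_imp_subset_eq) auto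
    moreover have "T = S \<union> T" using fin pos rev by (intro revenue_eq_imp_subset_eq) auto
    ultimately show ?thesis by simp
  qed
  show ?thesis using sub S_opt unique by blast
qed

end
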